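(* For every $h > 0$, every $\theta \in \mathbb{R}$, and every $f \in \mathcal{L-P}$ (the Laguerre–Pólya class), all the zeros of $T_{\theta,h}(f)$ are real and simple, where $$T_{\theta,h}(f)(x) = \frac{e^{i\theta} f(x+ih) - e^{-i\theta} f(x-ih)}{i}.$$
   Context: A real entire function $f$ belongs to the Laguerre–Pólya class, written $f \in \mathcal{L-P}$, if $$f(z) = c z^n e^{-a z^2 + b z} \prod_{k=1}^\infty \left(1 - \frac{z}{x_k}\right) e^{z/x_k},$$ where $c, b, x_k \in \mathbb{R}$, $x_k \neq 0$, $a \ge 0$, $n$ is a non-negative integer and $\sum_{k=1}^\infty x_k^{-2} < \infty$. The product on the right-hand side may be finite or empty (in the latter case it equals $1$).
   Formalization: The formal theorem additionally assumes that T_{θ,h}(f) is not identically zero; without this the claim is false, e.g. for f = 1 and θ = 0, where T_{θ,h}(f) vanishes everywhere. *)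

theory Defs
  imports "HOL-Complex_Analysis.Complex_Analysis"
begin

definition real_entire :: "(complex \<Rightarrow> complex) \<Rightarrow> bool" where
  "real_entire f \<longleftrightarrow> f holomorphic_on UNIV \<and> (\<forall>x::real. f (of_real x) \<in> \<real>)"

text \<open>
  The product over the nonzero zeros may be infinite, finite, or empty. A finite product has
  factors indexed by \<open>k < N\<close>, and \<open>N = 0\<close> is the empty product. The
  \<open>x k\<close> need not be distinct, so zeros are repeated according to multiplicity.
\<close>

definition canonical_product :: "(complex \<Rightarrow> complex) \<Rightarrow> bool" where
  "canonical_product P \<longleftrightarrow>
     (\<exists>(N::nat) (x :: nat \<Rightarrow> real). (\<forall>k<N. x k \<noteq> 0) \<and>
        (\<forall>z. P z = (\<Prod>k<N. (1 - z / of_real (x k)) * exp (z / of_real (x k))))) \<or>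
     (\<exists>x :: nat \<Rightarrow> real. (\<forall>k. x k \<noteq> 0) \<and> summable (\<lambda>k. 1 / (x k)\<^sup>2) \<and>
        (\<forall>z. P z = (\<Prod>k. (1 - z / of_real (x k)) * exp (z / of_real (x k)))))"

definition Laguerre_Polya :: "(complex \<Rightarrow> complex) set" where
  "Laguerre_Polya = {f. real_entire f \<and>
     (\<exists>(a::real) (b::real) (c::real) (n::nat) P. a \<ge> 0 \<and> canonical_product P \<and>
        (\<forall>z. f z = of_real c * z ^ n * exp (- of_real a * z\<^sup>2 + of_real b * z) * P z))}"

definition T_op :: "real \<Rightarrow> real \<Rightarrow> (complex \<Rightarrow> complex) \<Rightarrow> complex \<Rightarrow> complex" where
  "T_op \<theta> h f x =
     (exp (\<i> * of_real \<theta>) * f (x + \<i> * of_real h)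
      - exp (- \<i> * of_real \<theta>) * f (x - \<i> * of_real h)) / \<i>"

end

theory Submission
  imports Defs
begin

text \<open>
  Put \<open>F z = e\<^sup>i\<^sup>\<theta> f (z + i h)\<close> and \<open>G z = e\<^sup>-\<^sup>i\<^sup>\<theta> f (z - i h)\<close>. Every
  factor of \<open>f\<close> satisfies \<open>\<bar>g (z - i h)\<bar> \<le> \<bar>g (z + i h)\<bar>\<close> in the upper half-plane, and unless
  \<open>f\<close> is a pure exponential at least one factor gains a multiplicative constant \<open>1 - \<delta> y\<close> at
  \<open>z = x + i y\<close>, uniformly for bounded \<open>y > 0\<close>. Hence \<open>\<bar>G\<bar> < \<bar>F\<bar>\<close> off the real axis (by symmetry,
  the reverse holds below it), which excludes nonreal zeros of \<open>F - G\<close>. At a double zero \<open>x\<close> one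
  would have \<open>F - G = o(y)\<close> at \<open>x + i y\<close>, whereas the gain forces
  \<open>\<bar>F - G\<bar> \<ge> \<bar>F\<bar> - \<bar>G\<bar> \<ge> \<delta> y \<bar>F\<bar>\<close> with \<open>F x \<noteq> 0\<close>.
\<close>

section \<open>Comparing moduli at the two points shifted by \<open>h\<close> down and up\<close>

definition shift_le :: "real \<Rightarrow> (complex \<Rightarrow> complex) \<Rightarrow> bool" where
  "shift_le h g \<longleftrightarrow>
     (\<forall>x y. 0 < y \<longrightarrow> norm (g (Complex x (y - h))) \<le> norm (g (Complex x (y + h))))"

text \<open>The gain \<open>\<delta>\<close> may depend on \<open>x\<close> and \<open>Y\<close> but
  not on \<open>y\<close>. This uniformity as \<open>y\<close> tends to 0 is what later controls a
  derivative on the real axis. The form with a factor, rather than a strict inequality, tolerates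
  zeros of \<open>g\<close>.\<close>

definition shift_less :: "real \<Rightarrow> (complex \<Rightarrow> complex) \<Rightarrow> bool" where
  "shift_less h g \<longleftrightarrow>
     (\<forall>x Y. 0 < Y \<longrightarrow> (\<exists>\<delta>>0. \<forall>y. 0 < y \<and> y \<le> Y \<longrightarrow>
        norm (g (Complex x (y - h))) \<le> (1 - \<delta> * y) * norm (g (Complex x (y + h)))))"

lemma shift_le_mult:
  assumes "shift_le h f" "shift_le h g"
  shows "shift_le h (\<lambda>z. f z * g z)"
  using assms unfolding shift_le_def by (auto simp: norm_mult intro!: mult_mono)

text \<open>One factor with a gain suffices: the other can only help, so the same
  \<open>\<delta>\<close> serves the product.\<close>

lemma shift_less_mult:
  assumes "shift_less h f" "shift_le h g"
  shows "shift_less h (\<lambda>z. f z * g z)"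
  unfolding shift_less_def
proof (intro allI impI)
  fix x Y :: real
  assume "0 < Y"
  then obtain \<delta> where "\<delta> > 0" and \<delta>: "\<And>y. 0 < y \<and> y \<le> Y \<Longrightarrow>
      norm (f (Complex x (y - h))) \<le> (1 - \<delta> * y) * norm (f (Complex x (y + h)))"
    using assms(1) unfolding shift_less_def by blast
  have "norm (f (Complex x (y - h)) * g (Complex x (y - h)))
      \<le> (1 - \<delta> * y) * norm (f (Complex x (y + h)) * g (Complex x (y + h)))"
    if y: "0 < y \<and> y \<le> Y" for y
  proof -
    have "norm (f (Complex x (y - h))) * norm (g (Complex x (y - h)))
        \<le> ((1 - \<delta> * y) * norm (f (Complex x (y + h)))) * norm (g (Complex x (y + h)))"
    proof (rule mult_mono)
      show "norm (g (Complex x (y - h))) \<le> norm (g (Complex x (y + h)))"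
        using assms(2) y unfolding shift_le_def by blast
      \<comment> \<open>The sign of \<open>1 - \<delta> * y\<close> alone is unknown; the product is
        nonnegative because it bounds a norm.\<close>
      show "0 \<le> (1 - \<delta> * y) * norm (f (Complex x (y + h)))"
        using \<delta>[OF y] norm_ge_zero order_trans by blast
    qed (use \<delta>[OF y] in auto)
    thus ?thesis by (simp add: norm_mult mult_ac)
  qed
  thus "\<exists>\<delta>>0. \<forall>y. 0 < y \<and> y \<le> Y \<longrightarrow>
      norm (f (Complex x (y - h)) * g (Complex x (y - h)))
      \<le> (1 - \<delta> * y) * norm (f (Complex x (y + h)) * g (Complex x (y + h)))"
    using \<open>\<delta> > 0\<close> by blast
qed

lemma shift_less_imp_le:
  assumes "shift_less h g"
  shows "shift_le h g"
  unfolding shift_le_def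
proof (intro allI impI)
  fix x y :: real
  assume y: "0 < y"
  then obtain \<delta> where "\<delta> > 0" and
    \<delta>: "norm (g (Complex x (y - h))) \<le> (1 - \<delta> * y) * norm (g (Complex x (y + h)))"
    using assms unfolding shift_less_def by blast
  have "(1 - \<delta> * y) * norm (g (Complex x (y + h))) \<le> 1 * norm (g (Complex x (y + h)))"
    using \<open>\<delta> > 0\<close> y by (intro mult_right_mono) auto
  with \<delta> show "norm (g (Complex x (y - h))) \<le> norm (g (Complex x (y + h)))" by simp
qed

lemma shift_le_prod:
  assumes "\<And>k. k \<in> A \<Longrightarrow> shift_le h (g k)"
  shows "shift_le h (\<lambda>z. \<Prod>k\<in>A. g k z)"
  using assms unfolding shift_le_def by (auto simp: norm_mult prod_norm[symmetric] intro!: prod_mono)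

section \<open>Elementary factors: exponentials, linear terms, powers, Gaussians\<close>

text \<open>For real \<open>b\<close> the modulus of \<open>exp (b z)\<close> depends only on
  \<open>Re z\<close>, so equality holds.\<close>

lemma shift_le_exp_linear: "shift_le h (\<lambda>z. of_real c * exp (of_real b * z))"
  by (simp add: shift_le_def norm_mult)

text \<open>The squared distances from \<open>t\<close> to the two shifted points differ by exactly
  \<open>4 * h * y\<close>.\<close>

lemma shift_less_linear:
  assumes "h > 0"
  shows "shift_less h (\<lambda>z. z - of_real t)"
  unfolding shift_less_def
proof (intro allI impI)
  fix x Y :: real
  assume Y: "0 < Y"
  \<comment> \<open>\<open>D\<close> is the squared distance from \<open>t\<close> to the upper
    shifted point at the top height \<open>y = Y\<close>, the largest one that occurs; dividing by
    it makes the gain independent of \<open>y\<close>.\<close>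
  define D where "D = (x - t)\<^sup>2 + (Y + h)\<^sup>2"
  have D: "D > 0" using assms Y by (simp add: D_def add_nonneg_pos)
  have "norm (Complex x (y - h) - of_real t)
      \<le> (1 - 2 * h / D * y) * norm (Complex x (y + h) - of_real t)"
    if y: "0 < y \<and> y \<le> Y" for y
  proof -
    define s where "s = 2 * h / D * y"
    define N where "N = (x - t)\<^sup>2 + (y + h)\<^sup>2"
    have sD: "s * D = 2 * h * y" using D by (simp add: s_def)
    have s0: "s \<ge> 0" using D assms y by (simp add: s_def)
    have N: "N \<le> D" "N \<ge> 0"
      using y assms by (auto simp: N_def D_def intro!: power_mono)
    \<comment> \<open>This yields \<open>s \<le> 1/2\<close>, so \<open>1 - s\<close> is nonnegative
      when the square root is taken below.\<close>
    have "4 * h * y \<le> (y + h)\<^sup>2"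
      using zero_le_power2[of "y - h"] by (simp add: power2_eq_square algebra_simps)
    also have "\<dots> \<le> D" using N(1) unfolding N_def by (smt (verit) zero_le_power2)
    finally have "2 * (s * D) \<le> 1 * D" using sD by simp
    hence "2 * s \<le> 1" using D by simp
    have "s * N \<le> 2 * h * y" using mult_left_mono[OF N(1) s0] sD by simp
    hence "(x - t)\<^sup>2 + (y - h)\<^sup>2 \<le> (1 - 2 * s) * N"
      by (simp add: N_def power2_eq_square algebra_simps)
    \<comment> \<open>Completing the square costs only \<open>s\<^sup>2\<close> and turns the gain
      for squared moduli into one for moduli.\<close>
    also have "\<dots> \<le> (1 - s)\<^sup>2 * N"
      using N(2) by (intro mult_right_mono) (auto simp: power2_eq_square algebra_simps)
    finally have "sqrt ((x - t)\<^sup>2 + (y - h)\<^sup>2) \<le> sqrt ((1 - s)\<^sup>2 * N)"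
      by (rule real_sqrt_le_mono)
    also have "\<dots> = (1 - s) * sqrt N"
      using \<open>2 * s \<le> 1\<close> s0 by (simp add: real_sqrt_mult)
    finally show ?thesis by (simp add: cmod_def N_def s_def)
  qed
  moreover have "2 * h / D > 0" using D assms by simp
  ultimately show "\<exists>\<delta>>0. \<forall>y. 0 < y \<and> y \<le> Y \<longrightarrow>
      norm (Complex x (y - h) - of_real t)
      \<le> (1 - \<delta> * y) * norm (Complex x (y + h) - of_real t)"
    by blast
qed

lemma shift_less_power:
  assumes "h > 0" "n > 0"
  shows "shift_less h (\<lambda>z. z ^ n)"
proof -
  have z: "shift_less h (\<lambda>z. z)" using shift_less_linear[OF assms(1), of 0] by simp
  obtain m where n: "n = Suc m" using assms(2) by (cases n) auto
  have "shift_le h (\<lambda>z. \<Prod>k<m. z)" 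
    by (intro shift_le_prod shift_less_imp_le z)
  from shift_less_mult[OF z this] show ?thesis by (simp add: n)
qed

text \<open>The modulus at \<open>x + i v\<close> is
  \<open>exp (a * (v\<^sup>2 - x\<^sup>2))\<close>, so the ratio of the two moduli is
  \<open>exp (- (q * y))\<close>. The estimate
  \<open>exp (- u) \<le> 1 / (1 + u) = 1 - u / (1 + u)\<close> makes the gain linear in
  \<open>y\<close>.\<close>

lemma shift_less_gaussian:
  assumes "h > 0" "a > 0"
  shows "shift_less h (\<lambda>z. exp (- of_real a * z\<^sup>2))"
  unfolding shift_less_def
proof (intro allI impI)
  fix x Y :: real
  assume Y: "0 < Y"
  define q where "q = 4 * a * h"
  have q: "q > 0" using assms by (simp add: q_def)
  have eq: "norm (exp (- of_real a * (Complex x v)\<^sup>2)) = exp (a * (v\<^sup>2 - x\<^sup>2))" for v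
    by (simp add: power2_eq_square algebra_simps)
  have "norm (exp (- of_real a * (Complex x (y - h))\<^sup>2))
      \<le> (1 - q / (1 + q * Y) * y) * norm (exp (- of_real a * (Complex x (y + h))\<^sup>2))"
    if y: "0 < y \<and> y \<le> Y" for y
  proof -
    have pos: "0 < 1 + q * y" "0 < 1 + q * Y" using q y Y by (auto intro: add_pos_pos)
    \<comment> \<open>Passing to the largest denominator frees the gain from its dependence on
      \<open>y\<close>.\<close>
    have "q / (1 + q * Y) \<le> q / (1 + q * y)"
      using q y pos by (intro divide_left_mono) auto
    hence "q / (1 + q * Y) * y \<le> q / (1 + q * y) * y"
      using y by (intro mult_right_mono) auto
    moreover have "1 - q / (1 + q * y) * y = inverse (1 + q * y)"
      using pos by (simp add: field_simps)
    moreover have "exp (- (q * y)) \<le> inverse (1 + q * y)"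
      using pos exp_ge_add_one_self[of "q * y"] by (simp add: exp_minus le_imp_inverse_le)
    ultimately have "exp (- (q * y)) \<le> 1 - q / (1 + q * Y) * y" by linarith
    hence "exp (- (q * y)) * exp (a * ((y + h)\<^sup>2 - x\<^sup>2))
        \<le> (1 - q / (1 + q * Y) * y) * exp (a * ((y + h)\<^sup>2 - x\<^sup>2))"
      by (intro mult_right_mono) auto
    moreover have "exp (- (q * y)) * exp (a * ((y + h)\<^sup>2 - x\<^sup>2)) = exp (a * ((y - h)\<^sup>2 - x\<^sup>2))"
      unfolding exp_add[symmetric] q_def by (simp add: power2_eq_square algebra_simps)
    ultimately show ?thesis unfolding eq by simp
  qed
  moreover have "q / (1 + q * Y) > 0" using q Y by (simp add: add_pos_pos)
  ultimately show "\<exists>\<delta>>0. \<forall>y. 0 < y \<and> y \<le> Y \<longrightarrow>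
      norm (exp (- of_real a * (Complex x (y - h))\<^sup>2))
      \<le> (1 - \<delta> * y) * norm (exp (- of_real a * (Complex x (y + h))\<^sup>2))"
    by blast
qed

text \<open>The gain comes from \<open>z - t\<close>; the remaining constant and exponential have
  the same modulus at both points.\<close>

lemma shift_less_factor:
  assumes "h > 0" "t \<noteq> 0"
  shows "shift_less h (\<lambda>z. (1 - z / of_real t) * exp (z / of_real t))"
proof -
  have "shift_less h (\<lambda>z::complex. (z - of_real t) * (of_real (- 1 / t) * exp (of_real (1 / t) * z)))"
    by (rule shift_less_mult[OF shift_less_linear[OF assms(1)] shift_le_exp_linear])
  also have "(\<lambda>z::complex. (z - of_real t) * (of_real (- 1 / t) * exp (of_real (1 / t) * z)))
      = (\<lambda>z. (1 - z / of_real t) * exp (z / of_real t))"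
    using assms(2) by (auto simp: field_simps fun_eq_iff)
  finally show ?thesis .
qed

section \<open>Canonical products: convergence, gain, and absence of nonreal zeros\<close>

text \<open>Each factor is a Weierstrass factor of genus 1, which differs from 1 by at most
  \<open>3 * norm w ^ 2\<close> when \<open>norm w \<le> 1/2\<close>. With
  \<open>w = z / x k\<close> this is summable.\<close>

lemma convergent_prod_factor:
  fixes x :: "nat \<Rightarrow> real" and z :: complex
  assumes "\<And>k. x k \<noteq> 0" "summable (\<lambda>k. 1 / (x k)\<^sup>2)"
  shows "convergent_prod (\<lambda>k. (1 - z / of_real (x k)) * exp (z / of_real (x k)))"
proof -
  have eq: "(1 - w) * exp w = weierstrass_factor 1 w" for w
    by (simp add: weierstrass_factor_def)
  have sum: "summable (\<lambda>k. 3 * (norm z)\<^sup>2 * (1 / (x k)\<^sup>2))"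
    using assms(2) by (rule summable_mult)
  have n2: "norm (z / of_real (x k)) ^ 2 = (norm z)\<^sup>2 * (1 / (x k)\<^sup>2)" for k
    by (simp add: norm_divide power_divide)
  \<comment> \<open>The terms of a summable series tend to 0, so
    \<open>norm (z / x k) \<le> 1/2\<close> for all large \<open>k\<close>, where the Weierstrass
    bound applies.\<close>
  have "(\<lambda>k. (norm z)\<^sup>2 * (1 / (x k)\<^sup>2)) \<longlonglongrightarrow> (norm z)\<^sup>2 * 0"
    by (intro tendsto_mult tendsto_const summable_LIMSEQ_zero assms(2))
  hence "\<forall>\<^sub>F k in sequentially. (norm z)\<^sup>2 * (1 / (x k)\<^sup>2) < (1 / 2)\<^sup>2"
    by (rule order_tendstoD) simp
  hence "\<forall>\<^sub>F k in sequentially. norm (norm (weierstrass_factor 1 (z / of_real (x k)) - 1))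
      \<le> 3 * (norm z)\<^sup>2 * (1 / (x k)\<^sup>2)"
  proof eventually_elim
    case (elim k)
    hence "norm (z / of_real (x k)) ^ 2 < (1 / 2) ^ 2" by (simp only: n2)
    hence "norm (z / of_real (x k)) \<le> 1 / 2"
      using power_less_imp_less_base[of _ 2 "1/2 :: real"] less_imp_le by force
    from weierstrass_factor_bound[OF this, of 1] n2[of k] show ?case
      by (simp add: numeral_2_eq_2)
  qed
  from summable_comparison_test_ev[OF this sum] show ?thesis
    unfolding eq
    by (intro abs_convergent_prod_imp_convergent_prod summable_imp_abs_convergent_prod)
qed

text \<open>Weak inequalities between partial products pass to the limit. A gain need not survive
  it, so for infinite products it is taken from a single factor split off beforehand.\<close>

lemma shift_le_prodinf:
  assumes "\<And>k. shift_le h (g k)" "\<And>z. convergent_prod (\<lambda>k. g k z)"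
  shows "shift_le h (\<lambda>z. \<Prod>k. g k z)"
  unfolding shift_le_def
proof (intro allI impI)
  fix x y :: real
  assume y: "0 < y"
  have lim: "(\<lambda>n. norm (\<Prod>i\<le>n. g i z)) \<longlonglongrightarrow> norm (\<Prod>k. g k z)" for z
    by (intro tendsto_norm convergent_prod_LIMSEQ assms)
  have "shift_le h (\<lambda>z. \<Prod>i\<le>n. g i z)" for n
    by (intro shift_le_prod assms)
  with y show "norm (\<Prod>k. g k (Complex x (y - h))) \<le> norm (\<Prod>k. g k (Complex x (y + h)))"
    by (intro LIMSEQ_le[OF lim lim]) (auto simp: shift_le_def)
qed

text \<open>Unlike \<open>prodinf_split_head\<close>, this also covers a vanishing first factor.\<close>

lemma prodinf_head_mult:
  fixes g :: "nat \<Rightarrow> complex"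
  assumes "convergent_prod g" "convergent_prod (\<lambda>k. g (Suc k))"
  shows "prodinf g = g 0 * (\<Prod>k. g (Suc k))"
proof (rule LIMSEQ_unique)
  show "(\<lambda>n. \<Prod>i\<le>Suc n. g i) \<longlonglongrightarrow> prodinf g"
    using convergent_prod_LIMSEQ[OF assms(1)] by (rule LIMSEQ_Suc)
  show "(\<lambda>n. \<Prod>i\<le>Suc n. g i) \<longlonglongrightarrow> g 0 * (\<Prod>k. g (Suc k))"
    unfolding prod.atMost_Suc_shift
    by (intro tendsto_mult tendsto_const convergent_prod_LIMSEQ assms(2))
qed

text \<open>One factor supplies the gain, the last of a finite product or the first of an infinite
  one; the others only have to satisfy \<open>shift_le\<close>. The constant 1 arises from the empty
  product.\<close>

lemma canonical_product_shift:
  assumes h: "h > 0" and P: "canonical_product P"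
  shows "P = (\<lambda>_. 1) \<or> shift_less h P"
  using P unfolding canonical_product_def
proof (elim disjE exE conjE)
  fix N and x :: "nat \<Rightarrow> real"
  assume x: "\<forall>k<N. x k \<noteq> 0"
    and P: "\<forall>z. P z = (\<Prod>k<N. (1 - z / of_real (x k)) * exp (z / of_real (x k)))"
  show ?thesis
  proof (cases N)
    case 0
    with P show ?thesis by auto
  next
    case (Suc m)
    have "shift_less h (\<lambda>z. (1 - z / of_real (x m)) * exp (z / of_real (x m)) *
        (\<Prod>k<m. (1 - z / of_real (x k)) * exp (z / of_real (x k))))"
      using x Suc
      by (intro shift_less_mult shift_le_prod shift_less_imp_le shift_less_factor h) auto
    moreover have "P = (\<lambda>z. (1 - z / of_real (x m)) * exp (z / of_real (x m)) *
        (\<Prod>k<m. (1 - z / of_real (x k)) * exp (z / of_real (x k))))"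
      using P Suc by (auto simp: mult_ac)
    ultimately show ?thesis by simp
  qed
next
  fix x :: "nat \<Rightarrow> real"
  assume x: "\<forall>k. x k \<noteq> 0" and sum: "summable (\<lambda>k. 1 / (x k)\<^sup>2)"
    and P: "\<forall>z. P z = (\<Prod>k. (1 - z / of_real (x k)) * exp (z / of_real (x k)))"
  define g where "g = (\<lambda>k (z::complex). (1 - z / of_real (x k)) * exp (z / of_real (x k)))"
  have conv: "convergent_prod (\<lambda>k. g k z)" for z
    unfolding g_def using x sum by (intro convergent_prod_factor) auto
  have conv': "convergent_prod (\<lambda>k. g (Suc k) z)" for z
    unfolding g_def using x sum
    by (intro convergent_prod_factor) (auto simp: summable_Suc_iff[of "\<lambda>k. 1 / (x k)\<^sup>2"])
  have g: "shift_less h (g k)" for k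
    unfolding g_def using x by (intro shift_less_factor h) auto
  have "shift_less h (\<lambda>z. g 0 z * (\<Prod>k. g (Suc k) z))"
    by (intro shift_less_mult shift_le_prodinf shift_less_imp_le g conv')
  moreover have "P = (\<lambda>z. g 0 z * (\<Prod>k. g (Suc k) z))"
    using P prodinf_head_mult[OF conv conv'] by (auto simp: g_def)
  ultimately show ?thesis by simp
qed

text \<open>All \<open>x k\<close> are real, so no factor vanishes off the real axis, and a
  convergent product of nonzero factors is nonzero.\<close>

lemma canonical_product_nonzero:
  assumes P: "canonical_product P" and z: "Im z \<noteq> 0"
  shows "P z \<noteq> 0"
proof -
  have nz: "(1 - z / of_real t) * exp (z / of_real t) \<noteq> 0" if "t \<noteq> 0" for t :: real
    using z that by (auto simp: field_simps)
  from P show ?thesis unfolding canonical_product_def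
  proof (elim disjE exE conjE)
    fix N and x :: "nat \<Rightarrow> real"
    assume "\<forall>k<N. x k \<noteq> 0"
      and "\<forall>z. P z = (\<Prod>k<N. (1 - z / of_real (x k)) * exp (z / of_real (x k)))"
    thus ?thesis using nz by (simp del: mult_eq_0_iff)
  next
    fix x :: "nat \<Rightarrow> real"
    assume x: "\<forall>k. x k \<noteq> 0" "summable (\<lambda>k. 1 / (x k)\<^sup>2)"
      and P: "\<forall>z. P z = (\<Prod>k. (1 - z / of_real (x k)) * exp (z / of_real (x k)))"
    have "(\<Prod>k. (1 - z / of_real (x k)) * exp (z / of_real (x k))) \<noteq> 0"
      using x by (intro prodinf_nonzero convergent_prod_factor nz) auto
    thus ?thesis using P by simp
  qed
qed

section \<open>The dichotomy for the Laguerre-Polya class\<close>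

text \<open>If none of \<open>z ^ n\<close>, the Gaussian and the canonical product has a gain, all
  three are identically 1 and only the exponential is left.\<close>

lemma Laguerre_Polya_cases:
  assumes h: "h > 0" and f: "f \<in> Laguerre_Polya"
  obtains (exponential) b c :: real where "\<And>z. f z = of_real c * exp (of_real b * z)"
  | (shift_less) "shift_less h f" "\<And>z. Im z \<noteq> 0 \<Longrightarrow> f z \<noteq> 0"
proof -
  from f obtain a b c n P where a: "a \<ge> 0" and P: "canonical_product P"
    and f: "\<And>z. f z = of_real c * z ^ n * exp (- of_real a * z\<^sup>2 + of_real b * z) * P z"
    unfolding Laguerre_Polya_def by blast
  define E where "E = (\<lambda>z. complex_of_real c * exp (of_real b * z))"
  define Q where "Q = (\<lambda>z. exp (- complex_of_real a * z\<^sup>2))"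
  have fac: "f z = z ^ n * (Q z * (P z * E z))" for z
    unfolding f E_def Q_def exp_add by (simp add: mult_ac)
  have E: "shift_le h E" unfolding E_def by (rule shift_le_exp_linear)
  have n: "(\<lambda>z. z ^ n) = (\<lambda>_::complex. 1) \<or> shift_less h (\<lambda>z. z ^ n)"
    using shift_less_power[OF h, of n] by (cases "n = 0") auto
  have Q: "Q = (\<lambda>_. 1) \<or> shift_less h Q"
    unfolding Q_def using shift_less_gaussian[OF h, of a] a by (cases "a = 0") auto
  note PQ = canonical_product_shift[OF h P]
  have one: "shift_le h (\<lambda>_. 1)" by (simp add: shift_le_def)
  have le: "shift_le h P" "shift_le h Q" "shift_le h (\<lambda>z. z ^ n)"
    using PQ Q n one by (auto intro: shift_less_imp_le)
  consider "c = 0" | "c \<noteq> 0" "(\<lambda>z. z ^ n) = (\<lambda>_::complex. 1)" "Q = (\<lambda>_. 1)" "P = (\<lambda>_. 1)"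
    | "c \<noteq> 0" "shift_less h (\<lambda>z. z ^ n) \<or> shift_less h Q \<or> shift_less h P"
    using n Q PQ by blast
  thus ?thesis
  proof cases
    case 1
    \<comment> \<open>The zero function counts as a degenerate exponential.\<close>
    thus ?thesis using exponential[of 0 0] f by simp
  next
    case 2
    have "f z = of_real c * exp (of_real b * z)" for z
      using fac[of z] fun_cong[OF 2(2), of z] 2(3,4) by (simp add: E_def)
    thus ?thesis by (rule exponential)
  next
    case 3
    have "f z \<noteq> 0" if "Im z \<noteq> 0" for z
      using canonical_product_nonzero[OF P that] that 3(1) by (auto simp: f)
    moreover have "shift_less h f"
      \<comment> \<open>In each case the factors are permuted so that the one with the gain stands
        first, as \<open>shift_less_mult\<close> requires.\<close>
      using 3(2)
    proof (elim disjE)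
      assume "shift_less h (\<lambda>z. z ^ n)"
      hence "shift_less h (\<lambda>z. z ^ n * (Q z * (P z * E z)))"
        by (intro shift_less_mult shift_le_mult le E)
      thus ?thesis by (simp add: fac[abs_def])
    next
      assume "shift_less h Q"
      hence "shift_less h (\<lambda>z. Q z * (P z * (E z * z ^ n)))"
        by (intro shift_less_mult shift_le_mult le E)
      thus ?thesis by (simp add: fac[abs_def] mult_ac)
    next
      assume "shift_less h P"
      hence "shift_less h (\<lambda>z. P z * (E z * (z ^ n * Q z)))"
        by (intro shift_less_mult shift_le_mult le E)
      thus ?thesis by (simp add: fac[abs_def] mult_ac)
    qed
    ultimately show ?thesis using shift_less by blast
  qed
qed

section \<open>Conjugation symmetry and lower bounds for \<open>T_op\<close>\<close>

text \<open>Schwarz reflection by the identity theorem: \<open>cnj \<circ> f \<circ> cnj\<close> is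
  entire and agrees with \<open>f\<close> on the reals, which accumulate at 0.\<close>

lemma real_entire_cnj:
  assumes "real_entire f"
  shows "f (cnj z) = cnj (f z)"
proof -
  have hol: "f holomorphic_on UNIV" and real: "\<And>x::real. f (of_real x) \<in> \<real>"
    using assms by (auto simp: real_entire_def)
  have img: "cnj ` UNIV = UNIV" by (metis complex_cnj_cnj surjI)
  have hol': "(cnj \<circ> f \<circ> cnj) holomorphic_on UNIV"
    using holomorphic_on_compose_cnj_cnj[of f UNIV] hol img by simp
  have lim: "(0::complex) islimpt \<real>"
    unfolding islimpt_approachable
  proof (intro allI impI)
    fix e :: real
    assume "e > 0"
    thus "\<exists>x'\<in>\<real>. x' \<noteq> (0::complex) \<and> dist x' 0 < e"
      by (intro bexI[of _ "of_real (e / 2)"]) (auto simp: dist_norm)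
  qed
  have "(\<lambda>z. (cnj \<circ> f \<circ> cnj) z - f z) z = 0"
  proof (rule analytic_continuation[where f = "\<lambda>z. (cnj \<circ> f \<circ> cnj) z - f z" and S = UNIV
        and U = \<real> and \<xi> = 0])
    show "(\<lambda>z. (cnj \<circ> f \<circ> cnj) z - f z) holomorphic_on UNIV"
      by (intro holomorphic_on_diff hol hol')
    show "(cnj \<circ> f \<circ> cnj) w - f w = 0" if "w \<in> \<real>" for w
    proof -
      have "f w \<in> \<real>" using that real by (metis Reals_cases)
      with that show ?thesis by (simp add: Reals_cnj_iff)
    qed
  qed (use lim in auto)
  thus ?thesis by (metis comp_apply complex_cnj_cnj eq_iff_diff_eq_0)
qed

text \<open>Conjugation swaps the two terms of the numerator; the resulting sign is absorbed by the
  conjugate of the denominator \<open>\<i>\<close>.\<close>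

lemma T_op_cnj:
  assumes "real_entire f"
  shows "T_op \<theta> h f (cnj z) = cnj (T_op \<theta> h f z)"
proof -
  have "f (cnj z + \<i> * of_real h) = cnj (f (z - \<i> * of_real h))"
    using real_entire_cnj[OF assms, of "z - \<i> * of_real h"] by simp
  moreover have "f (cnj z - \<i> * of_real h) = cnj (f (z + \<i> * of_real h))"
    using real_entire_cnj[OF assms, of "z + \<i> * of_real h"] by simp
  ultimately show ?thesis
    by (simp add: T_op_def exp_cnj field_simps)
qed

text \<open>The reverse triangle inequality, since both phases and the denominator have modulus
  1.\<close>

lemma norm_T_op_ge:
  "norm (f (Complex x (y + h))) - norm (f (Complex x (y - h))) \<le> norm (T_op \<theta> h f (Complex x y))"
proof -
  have "Complex x y + \<i> * of_real h = Complex x (y + h)" "Complex x y - \<i> * of_real h = Complex x (y - h)"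
    by (auto simp: complex_eq_iff)
  thus ?thesis
    using norm_triangle_ineq2[of "exp (\<i> * of_real \<theta>) * f (Complex x (y + h))"
        "exp (- \<i> * of_real \<theta>) * f (Complex x (y - h))"]
    by (simp add: T_op_def norm_divide norm_mult)
qed

text \<open>This serves twice: at a fixed height it excludes zeros in the upper half-plane, and as
  \<open>y\<close> tends to 0 it excludes multiple real zeros.\<close>

lemma T_op_lower_bound:
  assumes "shift_less h f" "0 < Y"
  obtains \<delta> where "\<delta> > 0"
    "\<And>y. 0 < y \<Longrightarrow> y \<le> Y \<Longrightarrow> \<delta> * y * norm (f (Complex x (y + h))) \<le> norm (T_op \<theta> h f (Complex x y))"
proof -
  from assms obtain \<delta> where \<delta>: "\<delta> > 0" "\<And>y. 0 < y \<and> y \<le> Y \<Longrightarrow>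
      norm (f (Complex x (y - h))) \<le> (1 - \<delta> * y) * norm (f (Complex x (y + h)))"
    unfolding shift_less_def by blast
  show ?thesis
  proof (rule that[OF \<delta>(1)])
    fix y
    assume "0 < y" "y \<le> Y"
    with \<delta>(2)[of y] norm_T_op_ge[of f x y h \<theta>]
    show "\<delta> * y * norm (f (Complex x (y + h))) \<le> norm (T_op \<theta> h f (Complex x y))"
      by (simp add: algebra_simps)
  qed
qed

lemma T_op_upper_half_plane_nonzero:
  assumes "h > 0" "shift_less h f" "\<And>z. Im z \<noteq> 0 \<Longrightarrow> f z \<noteq> 0" "Im z > 0"
  shows "T_op \<theta> h f z \<noteq> 0"
proof -
  obtain \<delta> where "\<delta> > 0" and
    \<delta>: "\<And>y. 0 < y \<Longrightarrow> y \<le> Im z \<Longrightarrow>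
      \<delta> * y * norm (f (Complex (Re z) (y + h))) \<le> norm (T_op \<theta> h f (Complex (Re z) y))"
    using T_op_lower_bound[OF assms(2,4)] by blast
  have "f (Complex (Re z) (Im z + h)) \<noteq> 0" using assms by simp
  hence "0 < \<delta> * Im z * norm (f (Complex (Re z) (Im z + h)))"
    using \<open>\<delta> > 0\<close> assms(4) by simp
  with \<delta>[of "Im z"] assms(4) show ?thesis by auto
qed

text \<open>With a vanishing derivative the difference quotient along \<open>x + i y\<close> would
  tend to 0, yet its modulus is at least \<open>\<delta> * norm (f (x + i (y + h)))\<close>, whose
  limit \<open>\<delta> * norm (f (x + i h))\<close> is positive.\<close>

lemma T_op_deriv_nonzero:
  fixes x :: real
  assumes "h > 0" "shift_less h f" "\<And>z. Im z \<noteq> 0 \<Longrightarrow> f z \<noteq> 0" "f holomorphic_on UNIV"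
    and zero: "T_op \<theta> h f (of_real x) = 0"
    and deriv: "(T_op \<theta> h f has_field_derivative d) (at (of_real x))"
  shows "d \<noteq> 0"
proof
  assume "d = 0"
  define T where "T = T_op \<theta> h f"
  obtain \<delta> where "\<delta> > 0" and
    \<delta>: "\<And>y. 0 < y \<Longrightarrow> y \<le> 1 \<Longrightarrow> \<delta> * y * norm (f (Complex x (y + h))) \<le> norm (T (Complex x y))"
    \<comment> \<open>Any fixed height would do in place of 1, since only small \<open>y\<close>
      matter.\<close>
    unfolding T_def using T_op_lower_bound[OF assms(2) zero_less_one] by blast
  have line: "((\<lambda>y. Complex x y) \<longlongrightarrow> of_real x) (at_right 0)"
    unfolding Complex_eq by (auto intro!: tendsto_eq_intros)
  have "filterlim (\<lambda>y. Complex x y) (at (of_real x)) (at_right 0)"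
    unfolding filterlim_at using line eventually_at_right_less[of "0::real"]
    by (auto simp: complex_eq_iff elim: eventually_mono)
  moreover have "((\<lambda>w. T w / (w - of_real x)) \<longlongrightarrow> 0) (at (of_real x))"
    using deriv zero \<open>d = 0\<close> unfolding T_def has_field_derivative_iff by simp
  ultimately have "((\<lambda>y. T (Complex x y) / (Complex x y - of_real x)) \<longlongrightarrow> 0) (at_right 0)"
    by (rule filterlim_compose[rotated])
  hence quot: "((\<lambda>y. norm (T (Complex x y) / (Complex x y - of_real x))) \<longlongrightarrow> 0) (at_right 0)"
    by (rule tendsto_norm_zero)
  have "isCont f (Complex x h)"
    using assms(4) by (metis UNIV_I continuous_on_eq_continuous_at holomorphic_on_imp_continuous_on open_UNIV)
  moreover have "((\<lambda>y. Complex x (y + h)) \<longlongrightarrow> Complex x h) (at_right 0)"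
    unfolding Complex_eq by (auto intro!: tendsto_eq_intros)
  ultimately have "((\<lambda>y. f (Complex x (y + h))) \<longlongrightarrow> f (Complex x h)) (at_right 0)"
    by (rule isCont_tendsto_compose)
  hence low: "((\<lambda>y. \<delta> * norm (f (Complex x (y + h)))) \<longlongrightarrow> \<delta> * norm (f (Complex x h))) (at_right 0)"
    by (intro tendsto_intros)
  have "\<forall>\<^sub>F y in at_right 0. \<delta> * norm (f (Complex x (y + h)))
      \<le> norm (T (Complex x y) / (Complex x y - of_real x))"
    using eventually_at_right_real[of 0 1, OF zero_less_one]
  proof eventually_elim
    case (elim y)
    have "norm (Complex x y - of_real x) = y"
      using elim by (simp add: cmod_def)
    with \<delta>[of y] elim show ?case by (simp add: norm_divide field_simps)
  qed
  from tendsto_le[OF _ quot low this] have "\<delta> * norm (f (Complex x h)) \<le> 0" by simp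
  moreover have "f (Complex x h) \<noteq> 0" using assms(1,3) by simp
  ultimately show False using \<open>\<delta> > 0\<close> by (simp add: mult_le_0_iff)
qed

theorem theorem1p4:
  fixes h \<theta> :: real and f :: "complex \<Rightarrow> complex"
  assumes "h > 0"
    and "f \<in> Laguerre_Polya"
    and "\<exists>z. T_op \<theta> h f z \<noteq> 0"
  shows "\<forall>z. T_op \<theta> h f z = 0 \<longrightarrow> z \<in> \<real> \<and> zorder (T_op \<theta> h f) z = 1"
proof -
  have re: "real_entire f" using assms(2) by (simp add: Laguerre_Polya_def)
  hence hol: "f holomorphic_on UNIV" by (simp add: real_entire_def)
  have T_hol: "T_op \<theta> h f holomorphic_on UNIV"
  proof -
    have shift: "(\<lambda>z. f (z + w)) holomorphic_on UNIV" for w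
    proof -
      have "(f \<circ> (\<lambda>z. z + w)) holomorphic_on UNIV"
        by (rule holomorphic_on_compose_gen[of _ _ _ UNIV])
          (use hol in \<open>auto intro!: holomorphic_intros\<close>)
      thus ?thesis by (simp add: o_def)
    qed
    show ?thesis
      unfolding T_op_def[abs_def] using shift[of "\<i> * of_real h"] shift[of "- \<i> * of_real h"]
      by (auto intro!: holomorphic_intros)
  qed
  from assms(1,2) show ?thesis
  proof (cases rule: Laguerre_Polya_cases)
    case (exponential b c)
    \<comment> \<open>This pulls \<open>exp (b z)\<close> out of both terms, so \<open>T_op\<close>
      is that exponential times a constant. As \<open>T_op\<close> is not identically zero, the
      constant is nonzero and there are no zeros at all.\<close>
    have f: "f (z + w) = exp (of_real b * z) * f w" for z w
      by (simp add: exponential distrib_left exp_add)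
    have "T_op \<theta> h f z = exp (of_real b * z) * T_op \<theta> h f 0" for z
      using f[of z "\<i> * of_real h"] f[of z "- \<i> * of_real h"]
      by (simp add: T_op_def right_diff_distrib mult.left_commute)
    thus ?thesis using assms(3) by (metis exp_not_eq_zero mult_eq_0_iff)
  next
    case shift_less
    note up = T_op_upper_half_plane_nonzero[OF assms(1) shift_less, of _ \<theta>]
    show ?thesis
    proof (intro allI impI)
      fix z
      assume z: "T_op \<theta> h f z = 0"
      have "\<not> Im z > 0" using up z by blast
      \<comment> \<open>By symmetry \<open>cnj z\<close> is a zero too, which reduces the lower
        half-plane to the upper one.\<close>
      moreover have "\<not> Im (cnj z) > 0"
        using up[of "cnj z"] z T_op_cnj[OF re, of \<theta> h z] by auto
      ultimately have real: "z \<in> \<real>" by (simp add: complex_is_Real_iff)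
      then obtain x where x: "z = of_real x" by (rule Reals_cases)
      have "(T_op \<theta> h f has_field_derivative deriv (T_op \<theta> h f) z) (at z)"
        using T_hol by (intro holomorphic_derivI[of _ UNIV]) auto
      hence "deriv (T_op \<theta> h f) z \<noteq> 0"
        using T_op_deriv_nonzero[OF assms(1) shift_less hol] z unfolding x by blast
      hence "zorder (T_op \<theta> h f) z = 1"
        using z by (intro zorder_zero_eqI[OF T_hol]) auto
      with real show "z \<in> \<real> \<and> zorder (T_op \<theta> h f) z = 1" by simp
    qed
  qed
qed

end
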